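(* Let $k\ge1$ and let $\mathbf{T}(f)$ be a tridiagonal $k$-Toeplitz operator with real coefficients $a_i,b_i,c_i$ and symbol $f$, such that $b_ic_i>0$ for all $1\le i\le k$ and $\prod_{i=1}^k\frac{b_i}{c_i}>1$. Let $\lambda\in\sigma_{\mathrm{wind}}\setminus\sigma_{\mathrm{open}}$ be an eigenvalue (outside the Floquet spectrum $\sigma_{\mathrm{open}}$) and let $\mathbf{u}=(\mathbf{u}^{(i)})_{i\ge1}$ be an eigenvector of $\mathbf{T}(f)$ with eigenvalue $\lambda$. Then the entries of $\mathbf{u}$ decay exponentially, that is, $$\frac{|\mathbf{u}^{(i+k)}|}{|\mathbf{u}^{(i)}|}=\mathcal{O}\bigl(e^{-(r-\tilde\beta)}\bigr),$$ where $r=\frac12\log\bigl(\prod_{i=1}^k\frac{b_i}{c_i}\bigr)$ is fixed and $\tilde\beta=\tilde\beta(\lambda)=\operatorname{arccosh}\bigl(-\frac{g(\lambda)}{2Ae^{r}}\bigr)$ depends on the eigenvalue $\lambda$, the positive root of $\operatorname{arccosh}$ being chosen.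
   Context: A tridiagonal $k$-Toeplitz operator is the semi-infinite tridiagonal matrix (indices in $\mathbb{N}=\{1,2,\dots\}$) with diagonal entries $a_i$, superdiagonal entries $b_i$ in position $(i,i+1)$ and subdiagonal entries $c_i$ in position $(i+1,i)$, where $a_i,b_i,c_i\in\mathbb{R}$ are $k$-periodic in $i$. Let $\mathbf{A}_0$ be the $k\times k$ tridiagonal matrix with diagonal $a_1,\dots,a_k$, superdiagonal $b_1,\dots,b_{k-1}$, subdiagonal $c_1,\dots,c_{k-1}$; let $\mathbf{A}_{-1}$ be the $k\times k$ matrix with single nonzero entry $b_k$ in position $(k,1)$, and $\mathbf{A}_1$ the one with single nonzero entry $c_k$ in position $(1,k)$ (for $k=1$ these are the scalars $a_1,b_1,c_1$). The symbol is $f(z)=\mathbf{A}_{-1}z^{-1}+\mathbf{A}_0+\mathbf{A}_1z$. Notation: $A=(-1)^{k+1}\prod_{i=1}^kc_i$, and $g(\lambda)=\det(\mathbf{A}_0-\lambda\,\mathrm{Id})-b_kc_k\,p(\lambda)$, where $p=0$ if $k=1$, $p=1$ if $k=2$, and for $k\ge3$ $p(\lambda)$ is the determinant of the submatrix of $\mathbf{A}_0-\lambda\,\mathrm{Id}$ formed by rows and columns $2,\dots,k-1$. (Thus $\det(f(z)-\lambda\,\mathrm{Id})=Az+Bz^{-1}+g(\lambda)$ with $B=(-1)^{k+1}\prod_{i=1}^k b_i$.) The open (Floquet) spectrum is $\sigma_{\mathrm{open}}=\bigcup_{\alpha\in(-\pi,\pi]}\sigma\bigl(f(e^{-\mathrm{i}(\alpha+\mathrm{i}r)})\bigr)$,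 where $\sigma(M)$ is the set of eigenvalues of a matrix $M$. The winding region $\sigma_{\mathrm{wind}}$ is the set of $\lambda\in\mathbb{R}$ such that the closed curve $\theta\mapsto\det(f(e^{-\mathrm{i}\theta})-\lambda\,\mathrm{Id})$, $\theta$ from $0$ to $2\pi$, has winding number $>0$ around $0$. *)

theory Defs
  imports
    "HOL-Complex_Analysis.Complex_Analysis"
    "HOL-Library.Landau_Symbols"
    "Jordan_Normal_Form.Spectral_Radius"
    "Jordan_Normal_Form.DL_Submatrix"
begin

text \<open>
  Coefficient sequences and vectors are functions on \<open>nat\<close> whose entries are numbered from 1;
  the value at 0 is never used. Matrices of type \<open>_ mat\<close> are indexed from 0, so
  position \<open>(i, j)\<close> of such a matrix is position \<open>(i + 1, j + 1)\<close> in the usual numbering.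
\<close>

definition k_periodic :: "nat \<Rightarrow> (nat \<Rightarrow> real) \<Rightarrow> bool" where
  "k_periodic k x \<longleftrightarrow> (\<forall>i\<ge>1. x (i + k) = x i)"

definition toeplitz_entry ::
  "(nat \<Rightarrow> real) \<Rightarrow> (nat \<Rightarrow> real) \<Rightarrow> (nat \<Rightarrow> real) \<Rightarrow> nat \<Rightarrow> nat \<Rightarrow> real" where
  "toeplitz_entry a b c i j =
     (if j = i then a i else if j = i + 1 then b i else if i = j + 1 then c j else 0)"

text \<open>Row \<open>i\<close> vanishes outside the columns \<open>1, \<dots>, i + 1\<close>, so the matrix acts on every sequence.\<close>

definition toeplitz_apply ::
  "(nat \<Rightarrow> real) \<Rightarrow> (nat \<Rightarrow> real) \<Rightarrow> (nat \<Rightarrow> real) \<Rightarrow> (nat \<Rightarrow> complex) \<Rightarrow> nat \<Rightarrow> complex" where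
  "toeplitz_apply a b c u i = (\<Sum>j=1..i+1. of_real (toeplitz_entry a b c i j) * u j)"

text \<open>
  No summability is imposed on \<open>u\<close>; eigenvectors in any sequence space, in particular
  square-summable ones, are included.
\<close>

definition toeplitz_eigenvector ::
  "(nat \<Rightarrow> real) \<Rightarrow> (nat \<Rightarrow> real) \<Rightarrow> (nat \<Rightarrow> real) \<Rightarrow> real \<Rightarrow> (nat \<Rightarrow> complex) \<Rightarrow> bool" where
  "toeplitz_eigenvector a b c l u \<longleftrightarrow>
     (\<exists>i\<ge>1. u i \<noteq> 0) \<and> (\<forall>i\<ge>1. toeplitz_apply a b c u i = of_real l * u i)"

definition A_zero ::
  "nat \<Rightarrow> (nat \<Rightarrow> real) \<Rightarrow> (nat \<Rightarrow> real) \<Rightarrow> (nat \<Rightarrow> real) \<Rightarrow> real mat" where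
  "A_zero k a b c = Matrix.mat k k (\<lambda>(i, j). toeplitz_entry a b c (i + 1) (j + 1))"

definition A_minus :: "nat \<Rightarrow> (nat \<Rightarrow> real) \<Rightarrow> real mat" where
  "A_minus k b = Matrix.mat k k (\<lambda>(i, j). if i = k - 1 \<and> j = 0 then b k else 0)"

definition A_plus :: "nat \<Rightarrow> (nat \<Rightarrow> real) \<Rightarrow> real mat" where
  "A_plus k c = Matrix.mat k k (\<lambda>(i, j). if i = 0 \<and> j = k - 1 then c k else 0)"

definition symbol ::
  "nat \<Rightarrow> (nat \<Rightarrow> real) \<Rightarrow> (nat \<Rightarrow> real) \<Rightarrow> (nat \<Rightarrow> real) \<Rightarrow> complex \<Rightarrow> complex mat" where
  "symbol k a b c z =
     inverse z \<cdot>\<^sub>m map_mat of_real (A_minus k b)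
     + map_mat of_real (A_zero k a b c)
     + z \<cdot>\<^sub>m map_mat of_real (A_plus k c)"

definition coeff_A :: "nat \<Rightarrow> (nat \<Rightarrow> real) \<Rightarrow> real" where
  "coeff_A k c = (-1) ^ (k + 1) * (\<Prod>i=1..k. c i)"

definition p_fun ::
  "nat \<Rightarrow> (nat \<Rightarrow> real) \<Rightarrow> (nat \<Rightarrow> real) \<Rightarrow> (nat \<Rightarrow> real) \<Rightarrow> real \<Rightarrow> real" where
  "p_fun k a b c l =
     (if k = 1 then 0
      else if k = 2 then 1
      else Determinant.det
             (submatrix (A_zero k a b c - l \<cdot>\<^sub>m 1\<^sub>m k) {1..<k - 1} {1..<k - 1}))"

definition g_fun ::
  "nat \<Rightarrow> (nat \<Rightarrow> real) \<Rightarrow> (nat \<Rightarrow> real) \<Rightarrow> (nat \<Rightarrow> real) \<Rightarrow> real \<Rightarrow> real" where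
  "g_fun k a b c l =
     Determinant.det (A_zero k a b c - l \<cdot>\<^sub>m 1\<^sub>m k) - b k * c k * p_fun k a b c l"

definition r_rate :: "nat \<Rightarrow> (nat \<Rightarrow> real) \<Rightarrow> (nat \<Rightarrow> real) \<Rightarrow> real" where
  "r_rate k b c = 1 / 2 * ln (\<Prod>i=1..k. b i / c i)"

definition sigma_open ::
  "nat \<Rightarrow> (nat \<Rightarrow> real) \<Rightarrow> (nat \<Rightarrow> real) \<Rightarrow> (nat \<Rightarrow> real) \<Rightarrow> complex set" where
  "sigma_open k a b c =
     (\<Union>\<alpha>\<in>{-pi<..pi}. spectrum (symbol k a b c
        (exp (- (\<i> * (of_real \<alpha> + \<i> * of_real (r_rate k b c)))))))"

text \<open>The curve is parametrised over the unit interval by \<open>\<theta> = 2 \<pi> t\<close>.\<close>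

definition det_curve ::
  "nat \<Rightarrow> (nat \<Rightarrow> real) \<Rightarrow> (nat \<Rightarrow> real) \<Rightarrow> (nat \<Rightarrow> real) \<Rightarrow> real \<Rightarrow> real \<Rightarrow> complex" where
  "det_curve k a b c l t =
     Determinant.det
       (symbol k a b c (exp (- (\<i> * of_real (2 * pi * t)))) - of_real l \<cdot>\<^sub>m 1\<^sub>m k)"

text \<open>
  The constant \<open>winding_number\<close> is complex-valued (an integer for closed curves) and meaningful
  only off the curve, hence the explicit condition on the path image and the real part.
\<close>

definition sigma_wind ::
  "nat \<Rightarrow> (nat \<Rightarrow> real) \<Rightarrow> (nat \<Rightarrow> real) \<Rightarrow> (nat \<Rightarrow> real) \<Rightarrow> real set" where
  "sigma_wind k a b c =
     {l. 0 \<notin> path_image (det_curve k a b c l) \<and>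
         Re (winding_number (det_curve k a b c l) 0) > 0}"

text \<open>
  The argument of arccosh in the decay rate can be less than \<open>-1\<close>, where the inverse of cosh is
  not real. We therefore use the complex principal branch, whose real part is nonnegative. The
  library constant \<open>arcosh\<close> does not do this: at a real \<open>x < -1\<close>, its complex version has
  negative real part.
\<close>

definition arccosh_pos :: "complex \<Rightarrow> complex" where
  "arccosh_pos w = Ln (w + csqrt (w + 1) * csqrt (w - 1))"

lemma cosh_arccosh_pos: "cosh (arccosh_pos w) = w"
proof -
  define s where "s = csqrt (w + 1) * csqrt (w - 1)"
  have "s\<^sup>2 = (w + 1) * (w - 1)"
    unfolding s_def power_mult_distrib power2_csqrt ..
  then have prod: "(w + s) * (w - s) = 1"
    by (simp add: algebra_simps power2_eq_square)
  then have nz: "w + s \<noteq> 0"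
    by auto
  have "inverse (w + s) = w - s"
    using prod by (rule inverse_unique)
  then have "exp (- Ln (w + s)) = w - s"
    using nz by (simp add: exp_minus)
  then show ?thesis
    using nz unfolding arccosh_pos_def s_def[symmetric] by (simp add: cosh_field_def)
qed

lemma arccosh_pos_of_real_ge_1:
  assumes "(x::real) \<ge> 1"
  shows "arccosh_pos (of_real x) = of_real (arcosh x)"
proof -
  have 1: "csqrt (of_real x + 1) = of_real (sqrt (x + 1))"
    using assms csqrt_of_real_nonneg[of "of_real (x + 1)"] by simp
  have 2: "csqrt (of_real x - 1) = of_real (sqrt (x - 1))"
    using assms csqrt_of_real_nonneg[of "of_real (x - 1)"] by simp
  have 3: "sqrt (x + 1) * sqrt (x - 1) = sqrt (x\<^sup>2 - 1)"
    unfolding real_sqrt_mult[symmetric] by (simp add: algebra_simps power2_eq_square)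
  have pos: "x + sqrt (x\<^sup>2 - 1) > 0"
    using assms by (intro add_pos_nonneg) auto
  have "arccosh_pos (of_real x) = Ln (of_real (x + sqrt (x\<^sup>2 - 1)))"
    unfolding arccosh_pos_def 1 2 of_real_mult[symmetric] 3 of_real_add[symmetric] ..
  then show ?thesis
    using assms pos by (simp only: Ln_of_real arcosh_real_def)
qed

lemma arccosh_pos_of_real_le_minus_1:
  assumes "(x::real) \<le> -1"
  shows "arccosh_pos (of_real x) = of_real (arcosh (- x)) + \<i> * of_real pi"
proof -
  have 1: "csqrt (of_real x + 1) = \<i> * of_real (sqrt (- x - 1))"
    using assms csqrt_of_real_nonpos[of "of_real (x + 1)"] by (simp add: abs_if)
  have 2: "csqrt (of_real x - 1) = \<i> * of_real (sqrt (- x + 1))"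
    using assms csqrt_of_real_nonpos[of "of_real (x - 1)"] by (simp add: abs_if)
  have 3: "sqrt (- x - 1) * sqrt (- x + 1) = sqrt ((- x)\<^sup>2 - 1)"
    unfolding real_sqrt_mult[symmetric] by (simp add: algebra_simps power2_eq_square)
  define y where "y = - x + sqrt ((- x)\<^sup>2 - 1)"
  have pos: "y > 0"
    using assms one_le_power[of "- x" 2] unfolding y_def by (intro add_pos_nonneg) auto
  have "csqrt (of_real x + 1) * csqrt (of_real x - 1)
      = - of_real (sqrt (- x - 1) * sqrt (- x + 1))"
    unfolding 1 2 of_real_mult by (simp add: algebra_simps)
  then have "of_real x + csqrt (of_real x + 1) * csqrt (of_real x - 1) = of_real (- y)"
    unfolding 3 y_def by simp
  then have "arccosh_pos (of_real x) = Ln (- of_real y)"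
    unfolding arccosh_pos_def by simp
  also have "\<dots> = Ln (of_real y) + \<i> * of_real pi"
    using pos by (subst Ln_minus) auto
  also have "Ln (of_real y) = complex_of_real (ln y)"
    using pos by (rule Ln_of_real)
  also have "ln y = arcosh (- x)"
    using assms by (simp add: y_def arcosh_real_def)
  finally show ?thesis .
qed

definition beta_tilde ::
  "nat \<Rightarrow> (nat \<Rightarrow> real) \<Rightarrow> (nat \<Rightarrow> real) \<Rightarrow> (nat \<Rightarrow> real) \<Rightarrow> real \<Rightarrow> complex" where
  "beta_tilde k a b c l =
     arccosh_pos (of_real (- (g_fun k a b c l / (2 * coeff_A k c * exp (r_rate k b c)))))"

text \<open>
  The modulus of \<open>exp (- (r - \<beta>))\<close>: only the real part of \<open>\<beta>\<close> enters. Where the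
  argument of arccosh has absolute value at least 1, that is, off the open spectrum, this real part
  is the real arcosh of that absolute value.
\<close>

definition decay_factor ::
  "nat \<Rightarrow> (nat \<Rightarrow> real) \<Rightarrow> (nat \<Rightarrow> real) \<Rightarrow> (nat \<Rightarrow> real) \<Rightarrow> real \<Rightarrow> real" where
  "decay_factor k a b c l = cmod (exp (- (of_real (r_rate k b c) - beta_tilde k a b c l)))"

text \<open>
  The per-period factor must be less than 1 for decay. Since it is constant in the index, a Landau
  bound on \<open>\<bar>u (i + k)\<bar> / \<bar>u i\<bar>\<close> alone would not carry the rate; the last
  conjunct states it over any number of periods. The quotient bound is written in product form
  because entries may vanish: it also asserts that, for large \<open>i\<close>, \<open>u i = 0\<close>
  forces \<open>u (i + k) = 0\<close>.
\<close>

definition decays_per_period :: "nat \<Rightarrow> real \<Rightarrow> (nat \<Rightarrow> complex) \<Rightarrow> bool" where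
  "decays_per_period k q u \<longleftrightarrow>
     q < 1 \<and>
     (\<lambda>i. cmod (u (i + k))) \<in> O(\<lambda>i. q * cmod (u i)) \<and>
     (\<exists>C. \<forall>i\<ge>1. \<forall>n. cmod (u (i + n * k)) \<le> C * q ^ n)"

end

theory Submission
  imports Defs
begin

text \<open>
  A vector in the kernel of \<open>f(z) - \<lambda>\<close> extends to a sequence that is multiplied by \<open>1/z\<close> over each
  period and solves all rows of the eigenvalue equation but the first. Since
  \<open>det (f(z) - \<lambda>) = A z + B / z + g\<close> with \<open>B = A e\<^sup>2\<^sup>r\<close>, the multipliers \<open>1/z\<close> are the roots of
  \<open>B \<mu>\<^sup>2 + g \<mu> + A\<close>. Write \<open>x = - g / (2 A e\<^sup>r)\<close>. Off the open spectrum no root has modulus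
  \<open>e\<^sup>-\<^sup>r\<close>, which forces \<open>\<bar>x\<bar> > 1\<close>; the roots are then real and distinct, with moduli
  \<open>exp (- r - h)\<close> and \<open>exp (- r + h)\<close> where \<open>cosh h = \<bar>x\<bar>\<close>. Positive winding gives \<open>\<bar>x\<bar> < cosh r\<close>,
  hence \<open>h < r\<close>. The two Floquet sequences span the solutions of the three-term recurrence, so an
  eigenvector is a combination of them and decays at least at the slower rate.
\<close>

section \<open>Determinants of tridiagonal matrices with corner entries\<close>

text \<open>Laplace expansion along row \<open>i\<close>: the cofactors of that row do not see its
  entries, so the determinant is affine in the entry at \<open>(i, j)\<close> with the cofactor as
  slope.\<close>

lemma det_change_entry:
  fixes A B :: "'a :: comm_ring_1 mat"
  assumes A: "A \<in> carrier_mat n n" and B: "B \<in> carrier_mat n n"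
    and i: "i < n" and j: "j < n"
    and eq: "\<And>i' j'. i' < n \<Longrightarrow> j' < n \<Longrightarrow> (i', j') \<noteq> (i, j) \<Longrightarrow> B $$ (i', j') = A $$ (i', j')"
  shows "Determinant.det B = Determinant.det A + (B $$ (i, j) - A $$ (i, j)) * cofactor A i j"
proof -
  have "mat_delete B i j' = mat_delete A i j'" for j'
    by (rule eq_matI) (use A B i eq in \<open>auto simp: mat_delete_def\<close>)
  then have cof: "cofactor B i j' = cofactor A i j'" for j'
    by (simp add: cofactor_def)
  have split: "(\<Sum>j'<n. C $$ (i, j') * cofactor A i j') =
      C $$ (i, j) * cofactor A i j + (\<Sum>j'\<in>{..<n} - {j}. C $$ (i, j') * cofactor A i j')"
    for C :: "'a mat"
    using j by (intro sum.remove) auto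
  have "(\<Sum>j'\<in>{..<n} - {j}. B $$ (i, j') * cofactor A i j') =
      (\<Sum>j'\<in>{..<n} - {j}. A $$ (i, j') * cofactor A i j')"
    using i by (intro sum.cong) (auto simp: eq)
  then show ?thesis
    unfolding laplace_expansion_row[OF A i] laplace_expansion_row[OF B i] cof split
    by (simp add: algebra_simps)
qed

lemma det_lower_triangular_prod:
  fixes A :: "'a :: idom mat"
  assumes "\<And>i j. i < j \<Longrightarrow> j < n \<Longrightarrow> A $$ (i, j) = 0" and "A \<in> carrier_mat n n"
  shows "Determinant.det A = (\<Prod>i<n. A $$ (i, i))"
  using det_lower_triangular[OF assms] assms(2)
  by (simp add: prod_list_diag_prod lessThan_atLeast0)

lemma det_upper_triangular_prod:
  fixes A :: "'a :: idom mat"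
  assumes "\<And>i j. j < i \<Longrightarrow> i < n \<Longrightarrow> A $$ (i, j) = 0" and "A \<in> carrier_mat n n"
  shows "Determinant.det A = (\<Prod>i<n. A $$ (i, i))"
proof -
  have "upper_triangular A"
    using assms by (intro upper_triangularI) auto
  from det_upper_triangular[OF this assms(2)] show ?thesis
    using assms(2) by (simp add: prod_list_diag_prod lessThan_atLeast0)
qed

text \<open>The corners are switched off one at a time. With the other corner zero, the minor at a
  corner is triangular and its diagonal is one of the off-diagonals of \<open>h\<close>; with the
  other corner present, one further deletion leaves the inner block and produces the
  \<open>x * y\<close> term. Corners are added to \<open>h\<close> rather than put in place of its
  entries because for \<open>k = 2\<close> they sit on the off-diagonals.\<close>

lemma det_tridiagonal_corners:
  fixes h :: "nat \<Rightarrow> nat \<Rightarrow> 'a :: idom"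
  assumes up: "\<And>i j. Suc i < j \<Longrightarrow> h i j = 0" and lo: "\<And>i j. Suc j < i \<Longrightarrow> h i j = 0"
    and k: "k = Suc (Suc m)"
  shows "Determinant.det (Matrix.mat k k (\<lambda>(i, j). h i j
            + (if i = 0 \<and> j = k - 1 then x else 0) + (if i = k - 1 \<and> j = 0 then y else 0)))
    = Determinant.det (Matrix.mat k k (\<lambda>(i, j). h i j))
      + (-1) ^ (k + 1) * (x * (\<Prod>i<k - 1. h (Suc i) i) + y * (\<Prod>i<k - 1. h i (Suc i)))
      - x * y * Determinant.det (Matrix.mat m m (\<lambda>(i, j). h (Suc i) (Suc j)))"
proof -
  define M where "M x y = Matrix.mat k k (\<lambda>(i, j). h i j
    + (if i = 0 \<and> j = k - 1 then x else 0) + (if i = k - 1 \<and> j = 0 then y else 0))" for x y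
  \<comment> \<open>\<open>N y\<close> is the minor of \<open>M 0 y\<close> at the corner of
    \<open>x\<close>. The other corner survives in it at position \<open>(m, 0)\<close> and is
    expanded once more below.\<close>
  define N where "N y = Matrix.mat (Suc m) (Suc m)
    (\<lambda>(i, j). h (Suc i) j + (if i = m \<and> j = 0 then y else 0))" for y
  have "Determinant.det (M x y) = Determinant.det (M 0 y)
      + (M x y $$ (0, Suc m) - M 0 y $$ (0, Suc m)) * cofactor (M 0 y) 0 (Suc m)"
    by (rule det_change_entry[where n = k]) (auto simp: M_def k)
  also have "M x y $$ (0, Suc m) - M 0 y $$ (0, Suc m) = x"
    by (auto simp: M_def k)
  finally have 1: "Determinant.det (M x y) = Determinant.det (M 0 y) + x * cofactor (M 0 y) 0 (Suc m)" .
  have "Determinant.det (M 0 y) = Determinant.det (M 0 0)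
      + (M 0 y $$ (Suc m, 0) - M 0 0 $$ (Suc m, 0)) * cofactor (M 0 0) (Suc m) 0"
    by (rule det_change_entry[where n = k]) (auto simp: M_def k)
  also have "M 0 y $$ (Suc m, 0) - M 0 0 $$ (Suc m, 0) = y"
    by (auto simp: M_def k)
  finally have 2: "Determinant.det (M 0 y) = Determinant.det (M 0 0) + y * cofactor (M 0 0) (Suc m) 0" .
  have "Determinant.det (mat_delete (M 0 0) (Suc m) 0) =
      (\<Prod>i<Suc m. mat_delete (M 0 0) (Suc m) 0 $$ (i, i))"
    by (rule det_lower_triangular_prod) (auto simp: mat_delete_def M_def k up)
  also have "\<dots> = (\<Prod>i<Suc m. h i (Suc i))"
    by (rule prod.cong) (auto simp: mat_delete_def M_def k)
  finally have 3: "cofactor (M 0 0) (Suc m) 0 = (-1) ^ Suc m * (\<Prod>i<Suc m. h i (Suc i))"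
    by (simp add: cofactor_def)
  have "mat_delete (M 0 y) 0 (Suc m) = N y"
    by (rule eq_matI) (auto simp: mat_delete_def M_def N_def k)
  then have 4: "cofactor (M 0 y) 0 (Suc m) = (-1) ^ Suc m * Determinant.det (N y)"
    by (simp add: cofactor_def)
  have "Determinant.det (N y) = Determinant.det (N 0)
      + (N y $$ (m, 0) - N 0 $$ (m, 0)) * cofactor (N 0) m 0"
    by (rule det_change_entry[where n = "Suc m"]) (auto simp: N_def)
  also have "N y $$ (m, 0) - N 0 $$ (m, 0) = y"
    by (auto simp: N_def)
  finally have 5: "Determinant.det (N y) = Determinant.det (N 0) + y * cofactor (N 0) m 0" .
  have "Determinant.det (N 0) = (\<Prod>i<Suc m. N 0 $$ (i, i))"
    by (rule det_upper_triangular_prod) (auto simp: N_def lo)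
  also have "\<dots> = (\<Prod>i<Suc m. h (Suc i) i)"
    by (rule prod.cong) (auto simp: N_def)
  finally have 6: "Determinant.det (N 0) = (\<Prod>i<Suc m. h (Suc i) i)" .
  have "mat_delete (N 0) m 0 = Matrix.mat m m (\<lambda>(i, j). h (Suc i) (Suc j))"
    by (rule eq_matI) (auto simp: mat_delete_def N_def)
  then have 7: "cofactor (N 0) m 0 =
      (-1) ^ m * Determinant.det (Matrix.mat m m (\<lambda>(i, j). h (Suc i) (Suc j)))"
    by (simp add: cofactor_def)
  have 8: "M 0 0 = Matrix.mat k k (\<lambda>(i, j). h i j)"
    by (rule eq_matI) (auto simp: M_def)
  have sq: "(-1) ^ m * ((-1) ^ m * z) = z" for z :: 'a
    by (simp add: mult.assoc[symmetric] power_mult_distrib[symmetric])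
  show ?thesis
    unfolding M_def[symmetric] 1 2 3 4 5 6 7
    unfolding 8
    by (simp add: k sq algebra_simps del: prod.lessThan_Suc)
qed

section \<open>The determinant of the shifted symbol\<close>

text \<open>This brings \<open>p\<close> to the form of the inner block in the corner expansion. At
  \<open>m = 0\<close> the empty determinant is 1, matching the value set for
  \<open>k = 2\<close>.\<close>

lemma p_fun_eq:
  assumes "k = Suc (Suc m)"
  shows "p_fun k a b c l = Determinant.det (Matrix.mat m m
    (\<lambda>(i, j). toeplitz_entry a b c (i + 2) (j + 2) - (if i = j then l else 0)))"
proof (cases "m = 0")
  case True
  then show ?thesis using assms by (simp add: p_fun_def)
next
  case False
  \<comment> \<open>\<open>Suc i\<close> has exactly \<open>i\<close> smaller members in the index
    set, so it is the member that \<open>pick\<close> numbers \<open>i\<close>.\<close>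
  have pick: "pick {1..<k - 1} i = Suc i" if "i < m" for i
  proof -
    have "{a \<in> {1..<k - 1}. a < Suc i} = {1..<Suc i}"
      using that assms by auto
    then show ?thesis
      using pick_card_in_set[of "Suc i" "{1..<k - 1}"] that assms by simp
  qed
  have "{i. i < k \<and> Suc 0 \<le> i \<and> i < k - Suc 0} = {Suc 0..<Suc m}"
    using assms by auto
  then have card: "card {i. i < k \<and> Suc 0 \<le> i \<and> i < k - Suc 0} = m"
    by simp
  have less: "Suc i < k" if "i < m" for i
    using that assms by simp
  have "submatrix (A_zero k a b c - l \<cdot>\<^sub>m 1\<^sub>m k) {1..<k - 1} {1..<k - 1} =
      Matrix.mat m m
    (\<lambda>(i, j). toeplitz_entry a b c (i + 2) (j + 2) - (if i = j then l else 0))"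
    by (rule eq_matI)
      (simp_all add: submatrix_def A_zero_def card pick[simplified] less)
  then show ?thesis
    using False assms by (simp add: p_fun_def)
qed

definition coeff_B :: "nat \<Rightarrow> (nat \<Rightarrow> real) \<Rightarrow> real" where
  "coeff_B k b = (-1) ^ (k + 1) * (\<Prod>i=1..k. b i)"

lemma symbol_carrier [simp]: "symbol k a b c z \<in> carrier_mat k k"
  by (simp add: symbol_def A_minus_def A_zero_def A_plus_def)

lemma symbol_index:
  assumes "i < k" "j < k"
  shows "symbol k a b c z $$ (i, j) = of_real (toeplitz_entry a b c (i + 1) (j + 1))
    + (if i = 0 \<and> j = k - 1 then z * c k else 0)
    + (if i = k - 1 \<and> j = 0 then inverse z * b k else 0)"
  using assms by (simp add: symbol_def A_minus_def A_zero_def A_plus_def)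

text \<open>The corners are \<open>z * c k\<close> and \<open>inverse z * b k\<close>; their product
  no longer contains \<open>z\<close>, and this gives the \<open>p\<close> term of \<open>g\<close>.
  For \<open>k = 1\<close> both corners fall on the diagonal, so the corner expansion does not
  apply.\<close>

lemma det_symbol:
  assumes "k \<ge> 1" and "z \<noteq> 0"
  shows "Determinant.det (symbol k a b c z - of_real l \<cdot>\<^sub>m 1\<^sub>m k)
    = of_real (coeff_A k c) * z + of_real (coeff_B k b) * inverse z + of_real (g_fun k a b c l)"
proof (cases "k = 1")
  case True
  have "symbol k a b c z - of_real l \<cdot>\<^sub>m 1\<^sub>m k =
      Matrix.mat 1 1 (\<lambda>_. inverse z * b 1 + a 1 + z * c 1 - l)"
    by (rule eq_matI)
      (simp_all add: True symbol_def A_minus_def A_zero_def A_plus_def toeplitz_entry_def)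
  moreover have "A_zero k a b c - l \<cdot>\<^sub>m 1\<^sub>m k = Matrix.mat 1 1 (\<lambda>_. a 1 - l)"
    by (rule eq_matI) (simp_all add: True A_zero_def toeplitz_entry_def)
  ultimately show ?thesis
    by (simp add: True det_single g_fun_def p_fun_def coeff_A_def coeff_B_def)
next
  case False
  with assms have "k = Suc (Suc (k - 2))"
    by simp
  then obtain m where k: "k = Suc (Suc m)" ..
  define h where "h i j = toeplitz_entry a b c (i + 1) (j + 1) - (if i = j then l else 0)" for i j
  let ?h = "\<lambda>i j. complex_of_real (h i j)"
  have sym: "symbol k a b c z - of_real l \<cdot>\<^sub>m 1\<^sub>m k = Matrix.mat k k (\<lambda>(i, j). ?h i j
      + (if i = 0 \<and> j = k - 1 then z * c k else 0)
      + (if i = k - 1 \<and> j = 0 then inverse z * b k else 0))"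
    by (rule eq_matI) (simp_all add: symbol_index h_def symbol_carrier[THEN carrier_matD(1)]
      symbol_carrier[THEN carrier_matD(2)])
  have det: "Determinant.det (symbol k a b c z - of_real l \<cdot>\<^sub>m 1\<^sub>m k) =
      Determinant.det (Matrix.mat k k (\<lambda>(i, j). ?h i j))
      + (-1) ^ (k + 1) * (z * c k * (\<Prod>i<k - 1. ?h (Suc i) i)
          + inverse z * b k * (\<Prod>i<k - 1. ?h i (Suc i)))
      - z * c k * (inverse z * b k) *
          Determinant.det (Matrix.mat m m (\<lambda>(i, j). ?h (Suc i) (Suc j)))"
    unfolding sym
    by (rule det_tridiagonal_corners[OF _ _ k]) (auto simp: h_def toeplitz_entry_def)
  have lower: "h (Suc i) i = c (Suc i)" and upper: "h i (Suc i) = b (Suc i)" for i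
    by (simp_all add: h_def toeplitz_entry_def)
  \<comment> \<open>The corner coefficient \<open>x k\<close> completes the \<open>k - 1\<close>
    off-diagonal factors to a full period.\<close>
  have period: "(\<Prod>i=1..k. x i) = x k * (\<Prod>i<k - 1. x (Suc i))" for x :: "nat \<Rightarrow> real"
    by (simp add: k prod.atLeast1_atMost_eq mult.commute)
  have full: "Matrix.mat k k (\<lambda>(i, j). ?h i j) =
      map_mat of_real (A_zero k a b c - l \<cdot>\<^sub>m 1\<^sub>m k)"
    by (rule eq_matI) (simp_all add: A_zero_def h_def)
  have inner: "Matrix.mat m m (\<lambda>(i, j). ?h (Suc i) (Suc j)) =
      map_mat of_real (Matrix.mat m m
    (\<lambda>(i, j). toeplitz_entry a b c (i + 2) (j + 2) - (if i = j then l else 0)))"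
    by (rule eq_matI) (simp_all add: h_def)
  have "Determinant.det (symbol k a b c z - of_real l \<cdot>\<^sub>m 1\<^sub>m k) =
      of_real (Determinant.det (A_zero k a b c - l \<cdot>\<^sub>m 1\<^sub>m k))
      + (-1) ^ (k + 1) * (z * of_real (\<Prod>i=1..k. c i) + inverse z * of_real (\<Prod>i=1..k. b i))
      - of_real (b k * c k * p_fun k a b c l)"
    unfolding det full inner of_real_hom.hom_det p_fun_eq[OF k, symmetric] lower upper period
    using assms(2) by (simp add: field_simps)
  then show ?thesis
    by (simp add: g_fun_def coeff_A_def coeff_B_def algebra_simps)
qed

section \<open>The three-term recurrence behind the eigenvalue equation\<close>

lemma k_periodic_mult:
  assumes "k_periodic k x" and "i \<ge> 1"
  shows "x (i + n * k) = x i"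
proof (induction n)
  case (Suc n)
  have "x (i + n * k + k) = x (i + n * k)"
    using assms unfolding k_periodic_def by (metis trans_le_add1)
  with Suc show ?case by (simp add: algebra_simps)
qed simp

text \<open>
  Rows \<open>2, 3, \<dots>\<close> of the eigenvalue equation. Row 1 is left out: Floquet solutions
  need not satisfy it.
\<close>

definition interior_solution ::
  "(nat \<Rightarrow> real) \<Rightarrow> (nat \<Rightarrow> real) \<Rightarrow> (nat \<Rightarrow> real) \<Rightarrow> real \<Rightarrow> (nat \<Rightarrow> complex) \<Rightarrow> bool" where
  "interior_solution a b c l w \<longleftrightarrow>
     (\<forall>i\<ge>1. of_real (c i) * w i + of_real (a (i + 1) - l) * w (i + 1)
        + of_real (b (i + 1)) * w (i + 2) = 0)"

lemma toeplitz_apply_Suc: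
  assumes "i \<ge> 1"
  shows "toeplitz_apply a b c u (i + 1) =
    of_real (c i) * u i + of_real (a (i + 1)) * u (i + 1) + of_real (b (i + 1)) * u (i + 2)"
proof -
  have "toeplitz_apply a b c u (i + 1) =
      (\<Sum>j\<in>{i, i + 1, i + 2}. of_real (toeplitz_entry a b c (i + 1) j) * u j)"
    unfolding toeplitz_apply_def using assms
    by (intro sum.mono_neutral_right) (auto simp: toeplitz_entry_def)
  then show ?thesis
    by (simp add: toeplitz_entry_def)
qed

lemma eigenvector_interior_solution:
  assumes "toeplitz_eigenvector a b c l u"
  shows "interior_solution a b c l u"
  unfolding interior_solution_def
proof (intro allI impI)
  fix i :: nat
  assume "i \<ge> 1"
  moreover have "toeplitz_apply a b c u (i + 1) = of_real l * u (i + 1)"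
    using assms unfolding toeplitz_eigenvector_def by simp
  ultimately show "of_real (c i) * u i + of_real (a (i + 1) - l) * u (i + 1)
      + of_real (b (i + 1)) * u (i + 2) = 0"
    unfolding toeplitz_apply_Suc[OF \<open>i \<ge> 1\<close>] by (simp add: algebra_simps)
qed

lemma interior_solution_lincomb:
  assumes "interior_solution a b c l v" and "interior_solution a b c l w"
  shows "interior_solution a b c l (\<lambda>i. x * v i + y * w i)"
  unfolding interior_solution_def
proof (intro allI impI)
  fix i :: nat
  assume i: "i \<ge> 1"
  let ?L = "\<lambda>w. of_real (c i) * w i + of_real (a (i + 1) - l) * w (i + 1)
    + of_real (b (i + 1)) * w (i + 2)"
  have "?L (\<lambda>i. x * v i + y * w i) = x * ?L v + y * ?L w"
    by (simp add: algebra_simps)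
  also have "\<dots> = 0"
    using assms i unfolding interior_solution_def by simp
  finally show "?L (\<lambda>i. x * v i + y * w i) = 0" .
qed

text \<open>A nonzero superdiagonal lets each row be solved for its last unknown, so the solution
  space has dimension at most two.\<close>

lemma interior_solution_eq_0:
  assumes b: "\<And>i. i \<ge> 1 \<Longrightarrow> b i \<noteq> 0" and w: "interior_solution a b c l w"
    and init: "w 1 = 0" "w 2 = 0" and i: "i \<ge> 1"
  shows "w i = 0"
proof -
  have "w (n + 1) = 0 \<and> w (n + 2) = 0" for n
  proof (induction n)
    case (Suc n)
    have "of_real (c (n + 1)) * w (n + 1) + of_real (a (n + 2) - l) * w (n + 2)
        + of_real (b (n + 2)) * w (n + 3) = 0"
      using w[unfolded interior_solution_def, rule_format, of "n + 1"]
      by (simp add: eval_nat_numeral)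
    with Suc b[of "n + 2"] show ?case
      by (simp add: eval_nat_numeral)
  qed (use init in \<open>simp_all add: numeral_2_eq_2\<close>)
  from this[of "i - 1"] i show ?thesis by simp
qed

section \<open>Floquet solutions: existence and spanning\<close>

text \<open>The kernel equation becomes a recurrence on a cycle: the corners of the symbol supply
  the left neighbour \<open>z * f (k - 1)\<close> of the first entry and the right neighbour
  \<open>inverse z * f 0\<close> of the last. These are the values that a Floquet sequence takes
  across a block boundary.\<close>

lemma symbol_kernel_row:
  assumes v: "v \<in> carrier_vec k"
    and ker: "(symbol k a b c z - of_real l \<cdot>\<^sub>m 1\<^sub>m k) *\<^sub>v v = 0\<^sub>v k" and r: "r < k"
  defines "f \<equiv> vec_index v"
  shows "of_real (c (if r = 0 then k else r)) * (if r = 0 then z * f (k - 1) else f (r - 1))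
    + of_real (a (r + 1) - l) * f r
    + of_real (b (r + 1)) * (if Suc r = k then inverse z * f 0 else f (Suc r)) = 0"
proof -
  \<comment> \<open>One summand per possible nonzero column, each supported on a single
    \<open>j\<close>. They are added instead of separated by cases because for \<open>k = 1\<close>
    and \<open>k = 2\<close> these columns coincide; the inner test for \<open>r = 0\<close> guards
    the truncated \<open>r - 1\<close>.\<close>
  have entry: "(symbol k a b c z - of_real l \<cdot>\<^sub>m 1\<^sub>m k) $$ (r, j) * f j =
      (if j = r - 1 then (if r = 0 then 0 else of_real (c r) * f (r - 1)) else 0)
      + (if j = r then of_real (a (r + 1) - l) * f r else 0)
      + (if j = Suc r then of_real (b (r + 1)) * f (Suc r) else 0)
      + (if j = k - 1 then if r = 0 then z * c k * f (k - 1) else 0 else 0)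
      + (if j = 0 then if r = k - 1 then inverse z * b k * f 0 else 0 else 0)" if "j < k" for j
  proof -
    have "(symbol k a b c z - of_real l \<cdot>\<^sub>m 1\<^sub>m k) $$ (r, j) =
        of_real (toeplitz_entry a b c (r + 1) (j + 1))
      + (if r = 0 \<and> j = k - 1 then z * c k else 0)
      + (if r = k - 1 \<and> j = 0 then inverse z * b k else 0) - (if r = j then of_real l else 0)"
      using r that by (simp add: symbol_index symbol_carrier[THEN carrier_matD(1)]
          symbol_carrier[THEN carrier_matD(2)])
    also have "of_real (toeplitz_entry a b c (r + 1) (j + 1)) =
        (if j = r - 1 then (if r = 0 then 0 else complex_of_real (c r)) else 0)
      + (if j = r then of_real (a (r + 1)) else 0)
      + (if j = Suc r then of_real (b (r + 1)) else 0)"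
      by (auto simp: toeplitz_entry_def)
    finally have "(symbol k a b c z - of_real l \<cdot>\<^sub>m 1\<^sub>m k) $$ (r, j) =
        (if j = r - 1 then (if r = 0 then 0 else complex_of_real (c r)) else 0)
      + (if j = r then of_real (a (r + 1)) else 0)
      + (if j = Suc r then of_real (b (r + 1)) else 0)
      + (if r = 0 \<and> j = k - 1 then z * c k else 0)
      + (if r = k - 1 \<and> j = 0 then inverse z * b k else 0) - (if r = j then of_real l else 0)" .
    then show ?thesis
      by (simp only:) (auto simp: algebra_simps)
  qed
  have "0 = vec_index ((symbol k a b c z - of_real l \<cdot>\<^sub>m 1\<^sub>m k) *\<^sub>v v) r"
    unfolding ker using r by simp
  also have "\<dots> = (\<Sum>j<k. (symbol k a b c z - of_real l \<cdot>\<^sub>m 1\<^sub>m k) $$ (r, j) * f j)"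
    using r v by (simp add: scalar_prod_def f_def symbol_carrier[THEN carrier_matD(1)]
          symbol_carrier[THEN carrier_matD(2)] lessThan_atLeast0)
  also have "\<dots> = (if r = 0 then 0 else of_real (c r) * f (r - 1)) + of_real (a (r + 1) - l) * f r
      + (if Suc r < k then of_real (b (r + 1)) * f (Suc r) else 0)
      + (if r = 0 then z * c k * f (k - 1) else 0)
      + (if r = k - 1 then inverse z * b k * f 0 else 0)"
    by (subst sum.cong[OF refl entry[OF lessThan_iff[THEN iffD1]]])
      (use r in \<open>simp_all add: sum.distrib\<close>)
  finally have row: "0 = (if r = 0 then 0 else of_real (c r) * f (r - 1)) + of_real (a (r + 1) - l) * f r
      + (if Suc r < k then of_real (b (r + 1)) * f (Suc r) else 0)
      + (if r = 0 then z * c k * f (k - 1) else 0)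
      + (if r = k - 1 then inverse z * b k * f 0 else 0)" .
  show ?thesis
  proof (cases "Suc r = k")
    case True
    then have "k = Suc r"
      by simp
    with row show ?thesis
      by (auto simp: algebra_simps)
  next
    case False
    with row r show ?thesis
      by (auto simp: algebra_simps)
  qed
qed

definition floquet :: "nat \<Rightarrow> complex \<Rightarrow> (nat \<Rightarrow> complex) \<Rightarrow> bool" where
  "floquet k \<mu> w \<longleftrightarrow> (\<forall>i\<ge>1. w (i + k) = \<mu> * w i)"

lemma floquetD: "floquet k \<mu> w \<Longrightarrow> i \<ge> 1 \<Longrightarrow> w (i + k) = \<mu> * w i"
  by (simp add: floquet_def)

lemma exists_floquet_solution:
  assumes k: "k \<ge> 1" and per: "k_periodic k a" "k_periodic k b" "k_periodic k c"
    and z: "z \<noteq> 0" and det: "Determinant.det (symbol k a b c z - of_real l \<cdot>\<^sub>m 1\<^sub>m k) = 0"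
  obtains w where "interior_solution a b c l w" and "floquet k (inverse z) w"
    and "\<exists>i\<ge>1. w i \<noteq> 0"
proof -
  have "symbol k a b c z - of_real l \<cdot>\<^sub>m 1\<^sub>m k \<in> carrier_mat k k"
    by (simp add: minus_carrier_mat)
  with det obtain v where v: "v \<in> carrier_vec k" "v \<noteq> 0\<^sub>v k"
      and ker: "(symbol k a b c z - of_real l \<cdot>\<^sub>m 1\<^sub>m k) *\<^sub>v v = 0\<^sub>v k"
    using det_0_iff_vec_prod_zero by blast
  \<comment> \<open>Blocks of length \<open>k\<close>, each \<open>inverse z\<close> times its
    predecessor. Entries of \<open>w\<close> are numbered from 1 and those of \<open>v\<close> from
    0, hence \<open>i - 1\<close>.\<close>
  define w where "w i = inverse z ^ ((i - 1) div k) * vec_index v ((i - 1) mod k)" for i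
  have "interior_solution a b c l w"
    unfolding interior_solution_def
  proof (intro allI impI)
    fix i :: nat
    assume i: "i \<ge> 1"
    \<comment> \<open>The equation indexed by \<open>i\<close> is row \<open>i + 1\<close>, whose
      centre entry \<open>w (i + 1)\<close> is entry \<open>r\<close> of block
      \<open>m\<close>.\<close>
    define r m where "r = i mod k" and "m = i div k"
    have r: "r < k" and i_eq: "i = r + m * k"
      using k by (simp_all add: r_def m_def)
    have coeff: "a (i + 1) = a (r + 1)" "b (i + 1) = b (r + 1)"
      using k_periodic_mult[OF per(1), of "r + 1" m] k_periodic_mult[OF per(2), of "r + 1" m]
      by (simp_all add: i_eq add_ac)
    \<comment> \<open>At \<open>r = 0\<close> the subdiagonal entry links to the previous block, so
      \<open>c k\<close> and not \<open>c 0\<close> is the representative; \<open>i \<ge> 1\<close>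
      ensures that this block exists.\<close>
    have coeff_c: "c i = c (if r = 0 then k else r)"
    proof (cases "r = 0")
      case True
      then obtain m' where "m = Suc m'"
        using i i_eq by (cases m) auto
      then show ?thesis
        using k_periodic_mult[OF per(3) k, of m'] True i_eq by simp
    next
      case False
      then show ?thesis
        using k_periodic_mult[OF per(3), of r m] i_eq by simp
    qed
    obtain i' where i': "i = Suc i'"
      using i by (cases i) auto
    \<comment> \<open>For \<open>r = 0\<close> the entry \<open>w i\<close> ends block
      \<open>m - 1\<close>; the factor \<open>z\<close> makes up for the missing power of
      \<open>inverse z\<close>.\<close>
    have w0: "w i = inverse z ^ m * (if r = 0 then z * vec_index v (k - 1) else vec_index v (r - 1))"
    proof -
      have "n = k - Suc 0" if "Suc n = k" for n
        using that by simp
      then show ?thesis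
        using z k by (auto simp: w_def r_def m_def i' div_Suc mod_Suc)
    qed
    have w1: "w (i + 1) = inverse z ^ m * vec_index v r"
      by (simp add: w_def r_def m_def)
    have w2: "w (i + 2) = inverse z ^ m *
        (if Suc r = k then inverse z * vec_index v 0 else vec_index v (Suc r))"
      by (auto simp: w_def r_def m_def div_Suc mod_Suc)
    have "of_real (c i) * w i + of_real (a (i + 1) - l) * w (i + 1)
        + of_real (b (i + 1)) * w (i + 2) = inverse z ^ m *
        (of_real (c (if r = 0 then k else r)) *
            (if r = 0 then z * vec_index v (k - 1) else vec_index v (r - 1))
          + of_real (a (r + 1) - l) * vec_index v r
          + of_real (b (r + 1)) *
            (if Suc r = k then inverse z * vec_index v 0 else vec_index v (Suc r)))"
      unfolding w0 w1 w2 coeff coeff_c by (simp only: algebra_simps)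
    also have "\<dots> = 0"
      unfolding symbol_kernel_row[OF v(1) ker r] by simp
    finally show "of_real (c i) * w i + of_real (a (i + 1) - l) * w (i + 1)
        + of_real (b (i + 1)) * w (i + 2) = 0" .
  qed
  moreover have "floquet k (inverse z) w"
    unfolding floquet_def
  proof (intro allI impI)
    fix i :: nat
    assume "i \<ge> 1"
    then have shift: "i + k - 1 = (i - 1) + k"
      by simp
    show "w (i + k) = inverse z * w i"
      unfolding w_def shift using k by simp
  qed
  moreover have "\<exists>i\<ge>1. w i \<noteq> 0"
  proof -
    have "v = 0\<^sub>v k" if "\<forall>j<k. vec_index v j = 0"
      by (rule eq_vecI) (use that v(1) in auto)
    with v(2) obtain j where "j < k" "vec_index v j \<noteq> 0"
      by auto
    then have "w (j + 1) \<noteq> 0"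
      by (simp add: w_def)
    then show ?thesis
      by (intro exI[of _ "j + 1"]) simp
  qed
  ultimately show thesis
    by (rule that)
qed

text \<open>Multipliers act as eigenvalues of the shift by one period, so nonzero solutions with
  different multipliers are independent. Since a solution is determined by its first two entries,
  independence makes the determinant \<open>d\<close> of initial values nonzero, and any solution
  can be matched at 1 and 2.\<close>

lemma two_floquet_solutions_span:
  assumes b: "\<And>i. i \<ge> 1 \<Longrightarrow> b i \<noteq> 0"
    and v: "interior_solution a b c l v" "floquet k \<mu> v" "\<exists>i\<ge>1. v i \<noteq> 0"
    and w: "interior_solution a b c l w" "floquet k \<nu> w" "\<exists>i\<ge>1. w i \<noteq> 0"
    and ne: "\<mu> \<noteq> \<nu>" and u: "interior_solution a b c l u"
  obtains x y where "\<And>i. i \<ge> 1 \<Longrightarrow> u i = x * v i + y * w i"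
proof -
  define d where "d = v 1 * w 2 - v 2 * w 1"
  have indep: "x = 0 \<and> y = 0" if "\<And>i. i \<ge> 1 \<Longrightarrow> x * v i + y * w i = 0" for x y
  proof -
    have eq: "x * v i = 0 \<and> y * w i = 0" if "i \<ge> 1" for i
    proof -
      have 1: "x * v i + y * w i = 0" and 2: "\<mu> * (x * v i) + \<nu> * (y * w i) = 0"
        using \<open>\<And>i. i \<ge> 1 \<Longrightarrow> x * v i + y * w i = 0\<close>[of i]
          \<open>\<And>i. i \<ge> 1 \<Longrightarrow> x * v i + y * w i = 0\<close>[of "i + k"] floquetD[OF v(2) that] floquetD[OF w(2) that] that
        by (simp_all add: algebra_simps)
      \<comment> \<open>Subtracting \<open>\<nu>\<close> times the relation from the relation one
        period later isolates the \<open>v\<close> term.\<close>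
      have "(\<mu> - \<nu>) * (x * v i) = (\<mu> * (x * v i) + \<nu> * (y * w i)) - \<nu> * (x * v i + y * w i)"
        by (simp add: algebra_simps)
      also have "\<dots> = 0"
        unfolding 1 2 by simp
      finally show ?thesis
        using ne 1 by auto
    qed
    then show ?thesis
      using v(3) w(3) by auto
  qed
  have "d \<noteq> 0"
  proof
    assume d: "d = 0"
    \<comment> \<open>With \<open>d = 0\<close> this combination vanishes at 1 and 2, hence
      everywhere, and independence kills its coefficients. The same argument with the second entries
      then forces \<open>w\<close> to vanish.\<close>
    have "w 1 * v i + (- v 1) * w i = 0" if "i \<ge> 1" for i
      by (rule interior_solution_eq_0[OF b interior_solution_lincomb[OF v(1) w(1)]])
        (use d that in \<open>auto simp: d_def algebra_simps\<close>)
    from indep[OF this] have 1: "w 1 = 0" "v 1 = 0"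
      by auto
    have "w 2 * v i + (- v 2) * w i = 0" if "i \<ge> 1" for i
      by (rule interior_solution_eq_0[OF b interior_solution_lincomb[OF v(1) w(1)]])
        (use 1 that in auto)
    from indep[OF this] have "w 2 = 0"
      by auto
    then have "w i = 0" if "i \<ge> 1" for i
      using interior_solution_eq_0[OF b w(1) 1(1)] that by simp
    then show False
      using w(3) by auto
  qed
  \<comment> \<open>Cramer's rule for the initial values at 1 and 2.\<close>
  define x y where "x = (u 1 * w 2 - u 2 * w 1) / d" and "y = (v 1 * u 2 - v 2 * u 1) / d"
  have init: "x * v 1 + y * w 1 = u 1" "x * v 2 + y * w 2 = u 2"
    using \<open>d \<noteq> 0\<close> by (simp_all add: x_def y_def field_simps) (simp_all add: d_def algebra_simps)
  have "1 * u i + (- 1) * (x * v i + y * w i) = 0" if "i \<ge> 1" for i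
    by (rule interior_solution_eq_0[OF b
          interior_solution_lincomb[OF u interior_solution_lincomb[OF v(1) w(1)]]])
      (use init that in auto)
  then show thesis
    by (intro that) (simp add: algebra_simps)
qed

section \<open>Decay of combinations of Floquet sequences\<close>

lemma floquet_iterate:
  fixes x :: "nat \<Rightarrow> complex"
  assumes "floquet k \<mu> x" and "i \<ge> 1"
  shows "x (i + n * k) = \<mu> ^ n * x i"
proof (induction n)
  case (Suc n)
  have "x (i + n * k + k) = \<mu> * x (i + n * k)"
    using assms by (intro floquetD) auto
  with Suc show ?case by (simp add: algebra_simps)
qed simp

lemma index_decomposition:
  fixes i k :: nat
  assumes "k \<ge> 1" and "i \<ge> 1"
  shows "(i - 1) mod k + 1 \<in> {1..k}" and "i = (i - 1) mod k + 1 + (i - 1) div k * k"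
proof -
  show "(i - 1) mod k + 1 \<in> {1..k}"
    using assms mod_less_divisor[of k "i - 1"] by (simp add: Suc_le_eq)
  have "i = (i - 1) + 1"
    using assms by simp
  also have "i - 1 = (i - 1) mod k + (i - 1) div k * k"
    by simp
  finally show "i = (i - 1) mod k + 1 + (i - 1) div k * k"
    by simp
qed

lemma floquet_bounded:
  fixes x :: "nat \<Rightarrow> complex"
  assumes k: "k \<ge> 1" and x: "floquet k \<mu> x" and le: "cmod \<mu> \<le> 1"
  shows "\<exists>X. \<forall>i\<ge>1. cmod (x i) \<le> X"
proof (intro exI allI impI)
  fix i :: nat
  assume i: "i \<ge> 1"
  define r n where "r = (i - 1) mod k + 1" and "n = (i - 1) div k"
  have r: "r \<in> {1..k}" and i_eq: "i = r + n * k"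
    using index_decomposition[OF k i] by (simp_all add: r_def n_def)
  have "cmod (x i) = cmod \<mu> ^ n * cmod (x r)"
    using floquet_iterate[OF x, of r n] r by (simp add: i_eq norm_mult norm_power)
  also have "\<dots> \<le> cmod (x r)"
    using le by (intro mult_left_le_one_le) (auto intro: power_le_one)
  also have "\<dots> \<le> (\<Sum>j\<in>{1..k}. cmod (x j))"
    using r by (intro member_le_sum) auto
  finally show "cmod (x i) \<le> (\<Sum>j\<in>{1..k}. cmod (x j))" .
qed

text \<open>On each residue class modulo \<open>k\<close> both sequences are geometric, so their
  ratio tends to 0 unless \<open>y\<close> vanishes on the class; the finitely many classes share
  one threshold. The factor 2 serves to keep the sum of \<open>x\<close> and \<open>y\<close> at
  least half as large as \<open>y\<close>, so that the two cannot cancel.\<close>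

lemma floquet_eventually_dominated:
  fixes x y :: "nat \<Rightarrow> complex"
  assumes k: "k \<ge> 1"
    and x: "floquet k \<mu> x" and y: "floquet k \<nu> y"
    and less: "cmod \<mu> < cmod \<nu>"
  shows "eventually (\<lambda>i. y i = 0 \<or> 2 * cmod (x i) \<le> cmod (y i)) sequentially"
proof -
  have \<nu>: "cmod \<nu> > 0"
    using less by (meson norm_ge_zero le_less_trans)
  have "eventually (\<lambda>n. y r = 0 \<or> 2 * (cmod \<mu> ^ n * cmod (x r)) \<le> cmod \<nu> ^ n * cmod (y r))
      sequentially" for r
  proof (cases "y r = 0")
    case False
    have "(\<lambda>n. (cmod \<mu> / cmod \<nu>) ^ n) \<longlonglongrightarrow> 0"
      using less \<nu> by (intro LIMSEQ_realpow_zero) auto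
    then have "(\<lambda>n. (cmod \<mu> / cmod \<nu>) ^ n * (2 * cmod (x r))) \<longlonglongrightarrow> 0"
      by (rule tendsto_mult_left_zero)
    moreover have "0 < cmod (y r)"
      using False by simp
    ultimately have "eventually (\<lambda>n. (cmod \<mu> / cmod \<nu>) ^ n * (2 * cmod (x r)) < cmod (y r)) sequentially"
      by (rule order_tendstoD)
    then show ?thesis
    proof eventually_elim
      case (elim n)
      have "cmod \<nu> ^ n * ((cmod \<mu> / cmod \<nu>) ^ n * (2 * cmod (x r))) \<le> cmod \<nu> ^ n * cmod (y r)"
        using elim \<nu> by (intro mult_left_mono) auto
      then show ?case
        using \<nu> by (simp add: power_divide algebra_simps)
    qed
  qed simp
  then have "eventually (\<lambda>n. \<forall>r\<in>{1..k}. y r = 0 \<or>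
      2 * (cmod \<mu> ^ n * cmod (x r)) \<le> cmod \<nu> ^ n * cmod (y r)) sequentially"
    by (intro eventually_ball_finite) auto
  then obtain N where N: "\<And>n r. n \<ge> N \<Longrightarrow> r \<in> {1..k} \<Longrightarrow>
      y r = 0 \<or> 2 * (cmod \<mu> ^ n * cmod (x r)) \<le> cmod \<nu> ^ n * cmod (y r)"
    unfolding eventually_sequentially by blast
  show ?thesis
    unfolding eventually_sequentially
  proof (intro exI allI impI)
    fix i :: nat
    \<comment> \<open>\<open>N * k + 1\<close> is the first index in block number
      \<open>N\<close>.\<close>
    assume i: "i \<ge> N * k + 1"
    define r n where "r = (i - 1) mod k + 1" and "n = (i - 1) div k"
    have r: "r \<in> {1..k}" and i_eq: "i = r + n * k"
      using index_decomposition[OF k, of i] i by (simp_all add: r_def n_def)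
    have "n \<ge> N"
      unfolding n_def using i k by (subst less_eq_div_iff_mult_less_eq) auto
    from N[OF this r] show "y i = 0 \<or> 2 * cmod (x i) \<le> cmod (y i)"
      using floquet_iterate[OF x, of r n] floquet_iterate[OF y, of r n] r
      by (auto simp: i_eq norm_mult norm_power)
  qed
qed

text \<open>The slower multiplier \<open>\<nu>\<close> sets the rate. Either sequence may be
  identically zero, so combinations with a vanishing coefficient are covered.\<close>

lemma floquet_combination_decays:
  fixes x y u :: "nat \<Rightarrow> complex"
  assumes k: "k \<ge> 1"
    and x: "floquet k \<mu> x" and y: "floquet k \<nu> y"
    and less: "cmod \<mu> < cmod \<nu>" and less_1: "cmod \<nu> < 1"
    and u: "\<And>i. i \<ge> 1 \<Longrightarrow> u i = x i + y i"
  shows "decays_per_period k (cmod \<nu>) u"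
  unfolding decays_per_period_def
proof (intro conjI)
  show "(\<lambda>i. cmod (u (i + k))) \<in> O(\<lambda>i. cmod \<nu> * cmod (u i))"
  \<comment> \<open>If \<open>x\<close> is at most half of \<open>y\<close> in modulus, then the
    moduli add up to at most 3/2 of that of \<open>y\<close>, while \<open>u\<close> has at least
    1/2 of it: a ratio of at most 3. Where \<open>y\<close> vanishes, \<open>u\<close> equals
    \<open>x\<close>.\<close>
  proof (rule bigoI[where c = 3])
    show "eventually (\<lambda>i. norm (cmod (u (i + k))) \<le> 3 * norm (cmod \<nu> * cmod (u i))) sequentially"
      using floquet_eventually_dominated[OF k x y less] eventually_ge_at_top[of 1]
    proof eventually_elim
      case (elim i)
      have "u (i + k) = \<mu> * x i + \<nu> * y i"
        using u[of "i + k"] floquetD[OF x elim(2)] floquetD[OF y elim(2)] elim(2) by simp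
      then have "cmod (u (i + k)) \<le> cmod \<mu> * cmod (x i) + cmod \<nu> * cmod (y i)"
        by (metis norm_mult norm_triangle_ineq)
      also have "\<dots> \<le> cmod \<nu> * (cmod (x i) + cmod (y i))"
        using less mult_right_mono[of "cmod \<mu>" "cmod \<nu>" "cmod (x i)"] by (simp add: algebra_simps)
      also have "\<dots> \<le> cmod \<nu> * (3 * cmod (u i))"
      proof (rule mult_left_mono)
        have "cmod (y i) - cmod (x i) \<le> cmod (u i)"
          using norm_triangle_ineq2[of "y i" "- x i"] u[OF elim(2)] by (simp add: add.commute)
        moreover have "cmod (u i) = cmod (x i)" if "y i = 0"
          using u[OF elim(2)] that by simp
        ultimately show "cmod (x i) + cmod (y i) \<le> 3 * cmod (u i)"
          using elim(1) norm_ge_zero[of "x i"] by (cases "y i = 0") auto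
      qed simp
      finally show ?case
        by (simp add: algebra_simps)
    qed
  qed
next
  obtain X where X: "\<And>i. i \<ge> 1 \<Longrightarrow> cmod (x i) \<le> X"
    using floquet_bounded[OF k x] less less_1 by auto
  obtain Y where Y: "\<And>i. i \<ge> 1 \<Longrightarrow> cmod (y i) \<le> Y"
    using floquet_bounded[OF k y] less_1 by auto
  \<comment> \<open>Both summands are bounded over all indices, which makes the constant independent
    of \<open>i\<close>.\<close>
  show "\<exists>C. \<forall>i\<ge>1. \<forall>n. cmod (u (i + n * k)) \<le> C * cmod \<nu> ^ n"
  proof (intro exI allI impI)
    fix i n :: nat
    assume i: "i \<ge> 1"
    have "u (i + n * k) = \<mu> ^ n * x i + \<nu> ^ n * y i"
      using u[of "i + n * k"] floquet_iterate[OF x i] floquet_iterate[OF y i] i by simp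
    then have "cmod (u (i + n * k)) \<le> cmod \<mu> ^ n * cmod (x i) + cmod \<nu> ^ n * cmod (y i)"
      by (metis norm_mult norm_power norm_triangle_ineq)
    also have "\<dots> \<le> cmod \<nu> ^ n * X + cmod \<nu> ^ n * Y"
      using less X[OF i] Y[OF i] by (intro add_mono mult_mono power_mono) auto
    finally show "cmod (u (i + n * k)) \<le> (X + Y) * cmod \<nu> ^ n"
      by (simp add: algebra_simps)
  qed
qed (use less_1 in simp)

section \<open>Open spectrum, winding region and the branch of arccosh\<close>

lemma spectrum_iff_det:
  fixes M :: "complex mat"
  assumes M: "M \<in> carrier_mat n n"
  shows "e \<in> spectrum M \<longleftrightarrow> Determinant.det (M - e \<cdot>\<^sub>m 1\<^sub>m n) = 0"
proof -
  have "char_matrix M e = M - e \<cdot>\<^sub>m 1\<^sub>m n"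
    by (rule eq_matI) (use M in \<open>auto simp: char_matrix_def\<close>)
  moreover have "M - e \<cdot>\<^sub>m 1\<^sub>m n \<in> carrier_mat n n"
    by (simp add: minus_carrier_mat)
  ultimately show ?thesis
    by (simp add: spectrum_def eigenvalue_char_matrix[OF M] det_0_iff_vec_prod_zero)
qed

lemma k_periodic_nonzero:
  assumes k: "k \<ge> 1" and per: "k_periodic k x"
    and nz: "\<And>i. 1 \<le> i \<Longrightarrow> i \<le> k \<Longrightarrow> x i \<noteq> 0" and i: "i \<ge> 1"
  shows "x i \<noteq> 0"
  using index_decomposition[OF k i] k_periodic_mult[OF per, of "(i - 1) mod k + 1" "(i - 1) div k"]
    nz[of "(i - 1) mod k + 1"] by auto

lemma det_curve_eq:
  assumes "k \<ge> 1"
  shows "det_curve k a b c l t = Complex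
    ((coeff_A k c + coeff_B k b) * cos (2 * pi * t) + g_fun k a b c l)
    ((coeff_B k b - coeff_A k c) * sin (2 * pi * t))"
proof -
  have "exp (- (\<i> * of_real (2 * pi * t))) = cis (- (2 * pi * t))"
    by (simp add: cis_conv_exp)
  then have "det_curve k a b c l t =
      of_real (coeff_A k c) * cis (- (2 * pi * t)) + of_real (coeff_B k b) * cis (2 * pi * t)
      + of_real (g_fun k a b c l)"
    using det_symbol[OF assms, of "cis (- (2 * pi * t))" a b c l]
    by (simp only: det_curve_def) simp
  then show ?thesis
    by (simp add: complex_eq_iff algebra_simps)
qed

text \<open>
  The curve is an ellipse centred at \<open>g\<close> with horizontal semi-axis \<open>\<bar>A + B\<bar>\<close>. If
  \<open>\<bar>A + B\<bar> \<le> \<bar>g\<bar>\<close>, it meets 0 or stays in an open half-plane avoiding 0.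
\<close>

lemma sigma_wind_g_fun_less:
  assumes k: "k \<ge> 1" and l: "l \<in> sigma_wind k a b c"
  shows "\<bar>g_fun k a b c l\<bar> < \<bar>coeff_A k c + coeff_B k b\<bar>"
proof (rule ccontr)
  define g S where "g = g_fun k a b c l" and "S = coeff_A k c + coeff_B k b"
  let ?\<gamma> = "det_curve k a b c l"
  assume "\<not> \<bar>g_fun k a b c l\<bar> < \<bar>coeff_A k c + coeff_B k b\<bar>"
  then have ge: "\<bar>S\<bar> \<le> \<bar>g\<bar>"
    by (simp add: g_def S_def)
  have avoid: "0 \<notin> path_image ?\<gamma>" and wind: "Re (winding_number ?\<gamma> 0) > 0"
    using l by (simp_all add: sigma_wind_def)
  \<comment> \<open>These parameters give the points \<open>S + g\<close> and \<open>- S + g\<close>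
    of the curve on the real axis. That both differ from 0 makes the inequality strict.\<close>
  have "?\<gamma> 0 \<noteq> 0" "?\<gamma> (1 / 2) \<noteq> 0"
    using avoid unfolding path_image_def by force+
  then have "S + g \<noteq> 0" "- S + g \<noteq> 0"
    by (auto simp: det_curve_eq[OF k] g_def S_def complex_eq_iff)
  with ge have less: "\<bar>S\<bar> < \<bar>g\<bar>"
    by linarith
  \<comment> \<open>The open half-plane on the side of the centre \<open>g\<close>. It is convex and
    misses 0, so a closed curve inside it does not wind around 0.\<close>
  define H where "H = {w. sgn g * Re w > 0}"
  have "H = {w. inner (of_real (sgn g)) w > 0}"
    by (auto simp: H_def inner_complex_def)
  then have "convex H"
    by (simp add: convex_halfspace_gt)
  moreover have "path ?\<gamma>"
    unfolding path_def det_curve_eq[OF k] Complex_eq by (intro continuous_intros)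
  moreover have "pathfinish ?\<gamma> = pathstart ?\<gamma>"
    by (simp add: pathfinish_def pathstart_def det_curve_eq[OF k])
  moreover have "0 \<notin> H"
    by (simp add: H_def)
  moreover have "path_image ?\<gamma> \<subseteq> H"
  proof -
    have "sgn g * (S * cos \<theta> + g) > 0" for \<theta>
    proof -
      have "\<bar>S * cos \<theta>\<bar> \<le> \<bar>S\<bar>"
        unfolding abs_mult by (intro mult_left_le) auto
      then have "\<bar>S * cos \<theta>\<bar> < \<bar>g\<bar>"
        using less by linarith
      then show ?thesis
        by (auto simp: sgn_if abs_if split: if_splits)
    qed
    then show ?thesis
      unfolding path_image_def H_def by (auto simp: det_curve_eq[OF k] g_def S_def)
  qed
  ultimately have "winding_number ?\<gamma> 0 = 0"
    by (intro winding_number_zero_outside) auto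
  with wind show False
    by simp
qed

text \<open>Below -1 the principal value differs from the real arcosh of the absolute value only by
  the imaginary summand \<open>\<i> * pi\<close>.\<close>

lemma Re_arccosh_pos_of_real:
  assumes "\<bar>x\<bar> \<ge> 1"
  shows "Re (arccosh_pos (of_real x)) = arcosh \<bar>x\<bar>"
  using assms
  by (cases "x \<ge> 0") (auto simp: arccosh_pos_of_real_ge_1 arccosh_pos_of_real_le_minus_1)

section \<open>The decay rate of an eigenvector\<close>

theorem corollary2p8:
  fixes k :: nat
    and a b c :: "nat \<Rightarrow> real"
    and l :: real
    and u :: "nat \<Rightarrow> complex"
  assumes "k \<ge> 1"
    and "k_periodic k a" and "k_periodic k b" and "k_periodic k c"
    and "\<And>i. 1 \<le> i \<Longrightarrow> i \<le> k \<Longrightarrow> b i * c i > 0"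
    and "(\<Prod>i=1..k. b i / c i) > 1"
    and "l \<in> sigma_wind k a b c"
    and "complex_of_real l \<notin> sigma_open k a b c"
    and "toeplitz_eigenvector a b c l u"
  shows "decays_per_period k (decay_factor k a b c l) u"
proof -
  note k = assms(1)
  define A B g r where "A = coeff_A k c" and "B = coeff_B k b" and "g = g_fun k a b c l"
    and "r = r_rate k b c"
  define x where "x = - (g / (2 * A * exp r))"
  have bc: "b i \<noteq> 0" "c i \<noteq> 0" if "1 \<le> i" "i \<le> k" for i
    using assms(5)[OF that] by auto
  then have A: "A \<noteq> 0"
    by (auto simp: A_def coeff_A_def)
  have "exp r ^ 2 = exp (2 * r)"
    by (simp add: exp_double)
  also have "\<dots> = (\<Prod>i=1..k. b i / c i)"
    using assms(6) by (simp add: r_def r_rate_def)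
  finally have E2: "exp r ^ 2 = (\<Prod>i=1..k. b i / c i)" .
  then have B: "B = A * exp r ^ 2"
    using bc(2) by (simp add: A_def B_def coeff_A_def coeff_B_def prod_dividef)
  have g: "g = - (2 * A * exp r * x)"
    using A by (simp add: x_def)
  \<comment> \<open>In the scaled variable \<open>\<zeta> = z / exp r\<close> the bracket is
    \<open>exp r * (\<zeta> + inverse \<zeta> - 2 * x)\<close>. The roots \<open>\<zeta>\<close>
    come in reciprocal pairs with mean \<open>x\<close>.\<close>
  have det: "Determinant.det (symbol k a b c z - of_real l \<cdot>\<^sub>m 1\<^sub>m k) =
      of_real A * (z + of_real (exp r ^ 2) * inverse z - of_real (2 * exp r * x))"
    if "z \<noteq> 0" for z
    using det_symbol[OF k that, of a b c l]
    by (simp add: A_def[symmetric] B_def[symmetric] g_def[symmetric] B g algebra_simps)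

  have x_gt: "\<bar>x\<bar> > 1"
  proof (rule ccontr)
    assume "\<not> \<bar>x\<bar> > 1"
    then have x_le: "- 1 \<le> x" "x \<le> 1"
      by auto
    \<comment> \<open>For \<open>x\<close> in [-1, 1] the scaled roots are
      \<open>cis \<alpha>\<close> and \<open>cis (- \<alpha>)\<close> with
      \<open>cos \<alpha> = x\<close>. The corresponding \<open>z\<close> of modulus
      \<open>exp r\<close> is a point at which the open spectrum is sampled.\<close>
    define \<alpha> where "\<alpha> = arccos x"
    define z where "z = exp (- (\<i> * (of_real \<alpha> + \<i> * of_real r)))"
    have \<alpha>: "\<alpha> \<in> {- pi<..pi}"
      using arccos_lbound[OF x_le] arccos_ubound[OF x_le] pi_gt_zero
      unfolding \<alpha>_def greaterThanAtMost_iff by linarith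
    have z_eq: "z = of_real (exp r) * cis (- \<alpha>)"
      by (simp add: z_def cis_conv_exp exp_add[symmetric] exp_of_real[symmetric] algebra_simps)
    then have "of_real (exp r ^ 2) * inverse z = of_real (exp r) * cis \<alpha>"
      using cis_mult[of \<alpha> "- \<alpha>"] by (simp add: field_simps power2_eq_square)
    moreover have "cis (- \<alpha>) + cis \<alpha> = of_real (2 * x)"
      using x_le by (simp add: complex_eq_iff \<alpha>_def)
    then have "of_real (exp r) * cis (- \<alpha>) + of_real (exp r) * cis \<alpha> =
        complex_of_real (2 * exp r * x)"
      by (simp add: distrib_left[symmetric])
    ultimately have "z + of_real (exp r ^ 2) * inverse z - of_real (2 * exp r * x) = 0"
      by (simp only: z_eq) simp
    then have "Determinant.det (symbol k a b c z - of_real l \<cdot>\<^sub>m 1\<^sub>m k) = 0"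
      by (subst det) (auto simp: z_def)
    then have "of_real l \<in> spectrum (symbol k a b c z)"
      by (simp add: spectrum_iff_det[OF symbol_carrier])
    then show False
      using assms(8) \<alpha> unfolding sigma_open_def z_def r_def by blast
  qed

  define h where "h = arcosh \<bar>x\<bar>"
  have cosh_h: "cosh h = \<bar>x\<bar>" and h_pos: "h > 0"
    using x_gt by (simp_all add: h_def)
  have "r > 0"
    using assms(6) by (simp add: r_def r_rate_def)
  have "h < r"
  proof -
    \<comment> \<open>This is the winding bound in terms of \<open>x\<close>; cancelling the modulus
      of \<open>A\<close> and dividing by \<open>2 * exp r\<close> turns it into
      \<open>\<bar>x\<bar> < cosh r\<close>.\<close>
    have "\<bar>2 * A * exp r * x\<bar> < \<bar>A + A * exp r ^ 2\<bar>"
      using sigma_wind_g_fun_less[OF k assms(7)]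
      by (simp add: A_def[symmetric] B_def[symmetric] g_def[symmetric] B g)
    also have "A + A * exp r ^ 2 = A * (1 + exp r ^ 2)"
      by (simp add: algebra_simps)
    also have "\<bar>\<dots>\<bar> = \<bar>A\<bar> * (1 + exp r ^ 2)"
      using abs_of_nonneg[of "1 + exp r ^ 2"] by (simp add: abs_mult)
    finally have "\<bar>A\<bar> * (2 * exp r * \<bar>x\<bar>) < \<bar>A\<bar> * (1 + exp r ^ 2)"
      by (simp add: abs_mult algebra_simps)
    then have "2 * exp r * \<bar>x\<bar> < 1 + exp r ^ 2"
      using A by simp
    then have "cosh h < cosh r"
      unfolding cosh_h by (simp add: cosh_def exp_minus field_simps power2_eq_square)
    then show ?thesis
      using h_pos \<open>r > 0\<close> by (simp add: cosh_real_nonneg_less_iff)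
  qed

  \<comment> \<open>The scaled root is \<open>sgn x * exp t\<close>, whose mean with its reciprocal
    is \<open>sgn x * cosh t = x\<close>. Since \<open>cosh\<close> is even, both
    \<open>t = h\<close> and \<open>t = - h\<close> qualify.\<close>
  have root: "Determinant.det (symbol k a b c (of_real (sgn x * exp (r + t)))
      - of_real l \<cdot>\<^sub>m 1\<^sub>m k) = 0" if "cosh t = \<bar>x\<bar>" for t
  proof -
    have "sgn x * exp (r + t) + exp r ^ 2 * inverse (sgn x * exp (r + t)) - 2 * exp r * x
        = 2 * exp r * (sgn x * cosh t - x)"
      using x_gt by (auto simp: sgn_if cosh_def exp_add exp_minus field_simps power2_eq_square)
    also have "\<dots> = 0"
      unfolding that by (simp add: sgn_mult_abs)
    finally have "complex_of_real (sgn x * exp (r + t) + exp r ^ 2 * inverse (sgn x * exp (r + t))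
        - 2 * exp r * x) = 0"
      by simp
    then show ?thesis
      using x_gt by (subst det) (auto simp: sgn_if)
  qed
  define z1 z2 where "z1 = complex_of_real (sgn x * exp (r + h))"
    and "z2 = complex_of_real (sgn x * exp (r + - h))"
  have nz: "z1 \<noteq> 0" "z2 \<noteq> 0"
    using x_gt by (auto simp: z1_def z2_def sgn_if)
  have norms: "cmod (inverse z1) = exp (- r - h)" "cmod (inverse z2) = exp (- r + h)"
    using x_gt by (auto simp: z1_def z2_def sgn_if norm_inverse exp_minus[symmetric])
  have "\<And>i. i \<ge> 1 \<Longrightarrow> b i \<noteq> 0"
    using k_periodic_nonzero[OF k assms(3)] bc(1) by blast
  obtain v where v: "interior_solution a b c l v"
      "floquet k (inverse z1) v" "\<exists>i\<ge>1. v i \<noteq> 0"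
    using exists_floquet_solution[OF k assms(2-4) nz(1)] root[of h] cosh_h
    unfolding z1_def by metis
  obtain w where w: "interior_solution a b c l w"
      "floquet k (inverse z2) w" "\<exists>i\<ge>1. w i \<noteq> 0"
    using exists_floquet_solution[OF k assms(2-4) nz(2)] root[of "- h"] cosh_h
    unfolding z2_def by (metis cosh_minus)
  \<comment> \<open>Strictness in \<open>\<bar>x\<bar> > 1\<close> enters here: it gives
    \<open>h > 0\<close>, so the multipliers differ already in modulus, whereas \<open>h = 0\<close>
    would be a double root.\<close>
  have "inverse z1 \<noteq> inverse z2"
  proof
    assume "inverse z1 = inverse z2"
    with norms have "exp (- r - h) = exp (- r + h)"
      by simp
    with h_pos show False
      by simp
  qed
  then obtain p q where u: "\<And>i. i \<ge> 1 \<Longrightarrow> u i = p * v i + q * w i"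
    using two_floquet_solutions_span[OF \<open>\<And>i. i \<ge> 1 \<Longrightarrow> b i \<noteq> 0\<close> v w _
        eigenvector_interior_solution[OF assms(9)]]
    by blast
  have "decays_per_period k (cmod (inverse z2)) u"
    \<comment> \<open>Scaling by \<open>p\<close> and \<open>q\<close> preserves the multipliers.
      Here \<open>h > 0\<close> orders their moduli and \<open>h < r\<close> puts the larger one
      below 1.\<close>
    by (rule floquet_combination_decays[where x = "\<lambda>i. p * v i" and y = "\<lambda>i. q * w i"])
      (use k v(2) w(2) u norms h_pos \<open>h < r\<close> in \<open>auto simp: floquet_def\<close>)
  \<comment> \<open>The modulus of the exponential sees only the real part of
    \<open>beta_tilde\<close>, which is \<open>h\<close>.\<close>
  moreover have "decay_factor k a b c l = cmod (inverse z2)"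
    using x_gt Re_arccosh_pos_of_real[of x]
    by (simp add: decay_factor_def beta_tilde_def norms A_def[symmetric] g_def[symmetric]
        r_def[symmetric] x_def[symmetric] h_def del: of_real_minus of_real_divide)
  ultimately show ?thesis
    by simp
qed

end
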